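(* Let $V$ be an $n$-dimensional left vector space over a division ring, $2\le n<\infty$, and let $k\in\{1,\dots,n-1\}$. Every closeness preserving transformation of $\mathcal G_k\times\mathcal G_{n-k}$ is of one of the following forms: (1) $f'\times f''$ with bijections $f':\mathcal G_k\to\mathcal G_k$ and $f'':\mathcal G_{n-k}\to\mathcal G_{n-k}$; (2) $g'\mathbin{\dot\times}g''$ with bijections $g':\mathcal G_k\to\mathcal G_{n-k}$ and $g'':\mathcal G_{n-k}\to\mathcal G_k$.
   Context: $\mathcal G_i$ denotes the set of all $i$-dimensional subspaces of $V$. Elements $(S,U),(S',U')\in\mathcal G_k\times\mathcal G_{n-k}$ are close if ($S=S'$ and $U\ne U'$) or ($S\neq S'$ and $U=U'$). A closeness preserving transformation of $\mathcal G_k\times\mathcal G_{n-k}$ is a bijection $f$ of this set onto itself such that both $f$ and $f^{-1}$ map close elements to close elements. The map $f'\times f''$ is $(S,U)\mapsto(f'(S),f''(U))$, and the map $g'\mathbin{\dot\times}g''$ is $(S,U)\mapsto(g''(U),g'(S))$, both from $\mathcal G_k\times\mathcal G_{n-k}$ to itself. *)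

theory Defs
  imports Main
begin

(* The library locale vector_space requires a commutative field of scalars; this is its
   analogue for left vector spaces over an arbitrary division ring. *)
locale left_vector_space =
  fixes scale :: "'a::division_ring \<Rightarrow> 'v::ab_group_add \<Rightarrow> 'v"  (infixr \<open>*s\<close> 75)
  assumes scale_right_distrib: "a *s (x + y) = a *s x + a *s y"
    and scale_left_distrib: "(a + b) *s x = a *s x + b *s x"
    and scale_scale: "a *s (b *s x) = (a * b) *s x"
    and scale_one: "1 *s x = x"
begin

definition subspace :: "'v set \<Rightarrow> bool" where
  "subspace S \<longleftrightarrow> 0 \<in> S \<and> (\<forall>x\<in>S. \<forall>y\<in>S. x + y \<in> S) \<and> (\<forall>c. \<forall>x\<in>S. c *s x \<in> S)"

definition span :: "'v set \<Rightarrow> 'v set" where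
  "span B = {\<Sum>v\<in>t. r v *s v | t r. finite t \<and> t \<subseteq> B}"

definition independent :: "'v set \<Rightarrow> bool" where
  "independent B \<longleftrightarrow>
     (\<forall>t r. finite t \<and> t \<subseteq> B \<and> (\<Sum>v\<in>t. r v *s v) = 0 \<longrightarrow> (\<forall>v\<in>t. r v = 0))"

definition has_dim :: "'v set \<Rightarrow> nat \<Rightarrow> bool" where
  "has_dim S i \<longleftrightarrow> (\<exists>B. finite B \<and> card B = i \<and> independent B \<and> span B = S)"

definition grassmannian :: "nat \<Rightarrow> 'v set set" where
  "grassmannian i = {S. subspace S \<and> has_dim S i}"

end

definition close :: "'b \<times> 'c \<Rightarrow> 'b \<times> 'c \<Rightarrow> bool" where
  "close p q \<longleftrightarrow> (fst p = fst q \<and> snd p \<noteq> snd q) \<or> (fst p \<noteq> fst q \<and> snd p = snd q)"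

(* Only the values of f on X matter; its inverse is the inverse of the restriction to X. *)
definition closeness_preserving_on :: "('b \<times> 'c) set \<Rightarrow> ('b \<times> 'c \<Rightarrow> 'b \<times> 'c) \<Rightarrow> bool" where
  "closeness_preserving_on X f \<longleftrightarrow>
     bij_betw f X X \<and>
     (\<forall>p\<in>X. \<forall>q\<in>X. close p q \<longrightarrow> close (f p) (f q)) \<and>
     (\<forall>p\<in>X. \<forall>q\<in>X. close p q \<longrightarrow> close (inv_into X f p) (inv_into X f q))"

(* The crossed counterpart of map_prod. *)
definition dot_times :: "('b \<Rightarrow> 'c) \<Rightarrow> ('d \<Rightarrow> 'e) \<Rightarrow> 'b \<times> 'd \<Rightarrow> 'e \<times> 'c" where
  "dot_times g' g'' = (\<lambda>(S, U). (g'' U, g' S))"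

end

theory Submission
  imports Defs
begin

text \<open>
  Close pairs are the adjacent vertices of the rook's graph on \<open>A \<times> B\<close>, where
  \<open>A = G k\<close> and \<open>B = G (n - k)\<close>: two pairs are adjacent if exactly one coordinate changes. So the
  theorem says that an automorphism of a rook's graph acts on the two coordinates separately, up
  to exchanging them.

  The graph alone tells whether two edges \<open>p q\<close> and \<open>p r\<close> with a common end change the same
  coordinate: they do if and only if \<open>q\<close> and \<open>r\<close> are adjacent (\<open>close_iff_same_direction\<close>).
  An isomorphism therefore either keeps the direction of all edges at \<open>p\<close> or exchanges the
  direction of all of them (\<open>keeps_or_swaps\<close>). An edge imposes the same alternative on both of
  its ends, and any two vertices are joined by a path of at most two edges, so the alternative is
  the same at all vertices (\<open>keeps_everywhere\<close>). If directions are kept, pairs with the same first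
  coordinate have images with the same first coordinate, likewise for second coordinates, and
  \<open>f\<close> is a product map (\<open>product_if_keeps\<close>). If directions are exchanged, the same argument
  applies to \<open>prod.swap \<circ> f\<close>.
\<close>

definition close_iso :: "('a \<times> 'b) set \<Rightarrow> ('c \<times> 'd) set \<Rightarrow> ('a \<times> 'b \<Rightarrow> 'c \<times> 'd) \<Rightarrow> bool" where
  "close_iso X Y f \<longleftrightarrow>
     bij_betw f X Y \<and> (\<forall>p\<in>X. \<forall>q\<in>X. close (f p) (f q) \<longleftrightarrow> close p q)"

text \<open>For close pairs, equality of the first coordinates says that it is the second one that
  changes. Exchange of directions at \<open>p\<close> is expressed by applying this predicate to
  \<open>prod.swap \<circ> f\<close>.\<close>

definition keeps_directions_at ::
    "('a \<times> 'b) set \<Rightarrow> ('a \<times> 'b \<Rightarrow> 'c \<times> 'd) \<Rightarrow> 'a \<times> 'b \<Rightarrow> bool" where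
  "keeps_directions_at X f p \<longleftrightarrow>
     (\<forall>q\<in>X. close p q \<longrightarrow> (fst p = fst q \<longleftrightarrow> fst (f p) = fst (f q)))"

lemma close_sym: "close p q \<longleftrightarrow> close q p"
  by (auto simp: close_def)

lemma close_fst_iff: "close p q \<Longrightarrow> fst p = fst q \<longleftrightarrow> snd p \<noteq> snd q"
  by (auto simp: close_def)

lemma close_swap: "close (prod.swap p) (prod.swap q) \<longleftrightarrow> close p q"
  by (auto simp: close_def)

lemma close_iso_swap:
  assumes "close_iso X (C \<times> D) f"
  shows "close_iso X (D \<times> C) (prod.swap \<circ> f)"
proof -
  have "bij_betw prod.swap (C \<times> D) (D \<times> C)"
    by (auto simp: bij_betw_def inj_on_def)
  then show ?thesis
    using assms unfolding close_iso_def by (auto simp: close_swap intro: bij_betw_trans)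
qed

lemma close_iff_same_direction:
  assumes "close p q" "close p r" "q \<noteq> r"
  shows "close q r \<longleftrightarrow> (fst p = fst q \<longleftrightarrow> fst p = fst r)"
  using assms by (cases p; cases q; cases r) (auto simp: close_def)

text \<open>If one edge at \<open>p\<close> is kept in direction and another is not, then exactly one of the two
  pairs of edges, the original one and its image, has a common direction; this contradicts
  \<open>close_iff_same_direction\<close>.\<close>

lemma keeps_or_swaps:
  assumes f: "close_iso X Y f" and p: "p \<in> X"
  shows "keeps_directions_at X f p \<or> keeps_directions_at X (prod.swap \<circ> f) p"
proof (rule ccontr)
  assume "\<not> ?thesis"
  then obtain q r where q: "q \<in> X" "close p q" "\<not> (fst p = fst q \<longleftrightarrow> fst (f p) = fst (f q))"
    and r: "r \<in> X" "close p r" "\<not> (fst p = fst r \<longleftrightarrow> snd (f p) = snd (f r))"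
    unfolding keeps_directions_at_def by auto
  have fq: "close (f p) (f q)" and fr: "close (f p) (f r)"
    using f p q r unfolding close_iso_def by auto
  have r': "fst p = fst r \<longleftrightarrow> fst (f p) = fst (f r)"
    using r(3) close_fst_iff[OF fr] by blast
  then have "q \<noteq> r"
    using q(3) by auto
  moreover have "f q \<noteq> f r"
    using f q(1) r(1) \<open>q \<noteq> r\<close> unfolding close_iso_def bij_betw_def inj_on_def by blast
  moreover have "close (f q) (f r) \<longleftrightarrow> close q r"
    using f q(1) r(1) unfolding close_iso_def by auto
  ultimately show False
    using close_iff_same_direction[OF q(2) r(2)] close_iff_same_direction[OF fq fr] q(3) r' by blast
qed

text \<open>The edge \<open>p q\<close> is kept in direction, so \<open>q\<close> is not a vertex at which directions are
  exchanged.\<close>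

lemma keeps_at_neighbour:
  assumes f: "close_iso X Y f" and "p \<in> X" "q \<in> X" "close p q"
    and keep: "keeps_directions_at X f p"
  shows "keeps_directions_at X f q"
proof -
  have "close (f q) (f p)" "close q p"
    using assms close_sym unfolding close_iso_def by blast+
  moreover have "fst p = fst q \<longleftrightarrow> fst (f p) = fst (f q)"
    using keep assms unfolding keeps_directions_at_def by blast
  ultimately have "\<not> keeps_directions_at X (prod.swap \<circ> f) q"
    using close_fst_iff[of "f q" "f p"] \<open>p \<in> X\<close> unfolding keeps_directions_at_def by force
  then show ?thesis
    using keeps_or_swaps[OF f \<open>q \<in> X\<close>] by blast
qed

lemma keeps_everywhere:
  assumes f: "close_iso (A \<times> B) Y f" and p: "p \<in> A \<times> B"
    and keep: "keeps_directions_at (A \<times> B) f p" and q: "q \<in> A \<times> B"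
  shows "keeps_directions_at (A \<times> B) f q"
proof -
  let ?m = "(fst q, snd p)"
  have m: "?m \<in> A \<times> B"
    using p q by auto
  have "p = ?m \<or> close p ?m" "?m = q \<or> close ?m q"
    by (auto simp: close_def prod_eq_iff)
  then show ?thesis
    using keeps_at_neighbour[OF f p m] keeps_at_neighbour[OF f m q] keep by metis
qed

lemma product_if_keeps:
  assumes f: "close_iso (A \<times> B) (C \<times> D) f" and ne: "A \<times> B \<noteq> {}"
    and keep: "\<And>p. p \<in> A \<times> B \<Longrightarrow> keeps_directions_at (A \<times> B) f p"
  obtains g h where "bij_betw g A C" "bij_betw h B D" "\<forall>p\<in>A \<times> B. f p = map_prod g h p"
proof -
  obtain a0 b0 where a0: "a0 \<in> A" and b0: "b0 \<in> B"
    using ne by auto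
  have bij: "bij_betw f (A \<times> B) (C \<times> D)"
    and iso: "\<And>p q. p \<in> A \<times> B \<Longrightarrow> q \<in> A \<times> B \<Longrightarrow> close p q \<Longrightarrow> close (f p) (f q)"
    using f unfolding close_iso_def by blast+
  define g h where "g = (\<lambda>a. fst (f (a, b0)))" and "h = (\<lambda>b. snd (f (a0, b)))"
  have fst_f: "fst (f (a, b)) = g a" if "a \<in> A" "b \<in> B" for a b
  proof (cases "b = b0")
    case False
    then have "close (a, b) (a, b0)"
      by (simp add: close_def)
    then show ?thesis
      using keep[of "(a, b)"] that b0 unfolding keeps_directions_at_def g_def by force
  qed (simp add: g_def)
  have snd_f: "snd (f (a, b)) = h b" if "a \<in> A" "b \<in> B" for a b
  proof (cases "a = a0")
    case False
    then have "close (a, b) (a0, b)"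
      by (simp add: close_def)
    moreover from this have "close (f (a, b)) (f (a0, b))"
      using iso that a0 by simp
    ultimately show ?thesis
      using keep[of "(a, b)"] that a0 False close_fst_iff[of "f (a, b)" "f (a0, b)"]
      unfolding keeps_directions_at_def h_def by force
  qed (simp add: h_def)
  have f_eq: "f (a, b) = (g a, h b)" if "a \<in> A" "b \<in> B" for a b
    using fst_f[OF that] snd_f[OF that] by (simp add: prod_eq_iff)
  have inj: "a = a' \<and> b = b'"
    if "a \<in> A" "a' \<in> A" "b \<in> B" "b' \<in> B" "g a = g a'" "h b = h b'" for a a' b b'
  proof -
    have "f (a, b) = f (a', b')"
      using that by (simp add: f_eq)
    then show ?thesis
      using bij that unfolding bij_betw_def inj_on_def by blast
  qed
  have "f ` (A \<times> B) = g ` A \<times> h ` B"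
    using f_eq by force
  then have "g ` A \<times> h ` B = C \<times> D"
    using bij by (simp add: bij_betw_def)
  then have "g ` A = C" "h ` B = D"
    using a0 b0 by (auto simp: times_eq_iff)
  moreover have "inj_on g A" "inj_on h B"
    using inj[OF _ _ b0 b0] inj[OF a0 a0] by (auto intro!: inj_onI)
  ultimately show ?thesis
    using that f_eq by (auto simp: bij_betw_def)
qed

lemma close_iso_product_cases:
  assumes f: "close_iso (A \<times> B) (C \<times> D) f" and ne: "A \<times> B \<noteq> {}"
  shows "(\<exists>g h. bij_betw g A C \<and> bij_betw h B D \<and> (\<forall>p\<in>A \<times> B. f p = map_prod g h p)) \<or>
         (\<exists>g h. bij_betw g A D \<and> bij_betw h B C \<and> (\<forall>p\<in>A \<times> B. f p = dot_times g h p))"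
proof -
  obtain p where p: "p \<in> A \<times> B"
    using ne by blast
  from keeps_or_swaps[OF f p] show ?thesis
  proof
    assume "keeps_directions_at (A \<times> B) f p"
    then show ?thesis
      using product_if_keeps[OF f ne keeps_everywhere[OF f p]] by metis
  next
    have swap: "close_iso (A \<times> B) (D \<times> C) (prod.swap \<circ> f)"
      using f by (rule close_iso_swap)
    assume "keeps_directions_at (A \<times> B) (prod.swap \<circ> f) p"
    then obtain g h where "bij_betw g A D" "bij_betw h B C"
      and eq: "\<forall>p\<in>A \<times> B. (prod.swap \<circ> f) p = map_prod g h p"
      using product_if_keeps[OF swap ne keeps_everywhere[OF swap p]] by metis
    moreover have "f p = dot_times g h p" if "p \<in> A \<times> B" for p
      using eq that by (cases p) (force simp: dot_times_def prod_eq_iff)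
    ultimately show ?thesis
      by blast
  qed
qed

lemma closeness_preserving_imp_close_iso:
  assumes "closeness_preserving_on X f"
  shows "close_iso X X f"
proof -
  have bij: "bij_betw f X X"
    and inv: "\<And>p q. p \<in> X \<Longrightarrow> q \<in> X \<Longrightarrow> close p q \<Longrightarrow> close (inv_into X f p) (inv_into X f q)"
    using assms unfolding closeness_preserving_on_def by blast+
  have "close p q" if "p \<in> X" "q \<in> X" "close (f p) (f q)" for p q
    using inv[of "f p" "f q"] that bij by (simp add: bij_betw_apply bij_betw_inv_into_left)
  then show ?thesis
    using assms unfolding closeness_preserving_on_def close_iso_def by blast
qed

theorem theorem3:
  fixes scale :: "'a::division_ring \<Rightarrow> 'v::ab_group_add \<Rightarrow> 'v"
    and n k :: nat
    and G :: "nat \<Rightarrow> 'v set set"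
    and f :: "'v set \<times> 'v set \<Rightarrow> 'v set \<times> 'v set"
  assumes "left_vector_space scale"
    and "left_vector_space.has_dim scale UNIV n"
    and "2 \<le> n"
    and "k \<in> {1..n - 1}"
    and "G = left_vector_space.grassmannian scale"
    and "closeness_preserving_on (G k \<times> G (n - k)) f"
  shows "(\<exists>f' f''. bij_betw f' (G k) (G k) \<and> bij_betw f'' (G (n - k)) (G (n - k)) \<and>
            (\<forall>p \<in> G k \<times> G (n - k). f p = map_prod f' f'' p)) \<or>
         (\<exists>g' g''. bij_betw g' (G k) (G (n - k)) \<and> bij_betw g'' (G (n - k)) (G k) \<and>
            (\<forall>p \<in> G k \<times> G (n - k). f p = dot_times g' g'' p))"
proof (cases "G k \<times> G (n - k) = {}")
  case True
  then show ?thesis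
    by (metis bij_betw_id empty_iff)
next
  case False
  with closeness_preserving_imp_close_iso[OF assms(6)] show ?thesis
    by (rule close_iso_product_cases)
qed

end
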